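(* Let $a<b$ be real, $Z\subseteq\mathbb{R}^n\times\mathbb{R}^m$ permutation-invariant with respect to $x$, and $\mathcal{F}=\{F_1,\dots,F_r\}$ a permutation-invariant collection of faces of $[a,b]^n$. Let $I=\{i\in\{1,\dots,r\}\mid$ there exist integers $0\le p<q\le n+1$ with $u(F_i)=\{1,\dots,p\}$ and $l(F_i)=\{q,\dots,n\}\}$ (where $\{1,\dots,0\}$ and $\{n+1,\dots,n\}$ denote the empty set). Then $$\mathrm{conv}(X(Z,a,b,\mathcal{F}))=\Big\{(x,z)\ \Big|\ \exists u:\ (u,z)\in\mathrm{conv}\Big(\bigcup_{i\in I}X(Z,a,b,\{F_i\})\Big),\ u_1\ge\dots\ge u_n,\ u\ge_m x\Big\}.$$
   Context: $Z$ is permutation-invariant with respect to $x$ if $(x,z)\in Z$ implies $(Qx,z)\in Z$ for every permutation matrix $Q$. For a collection $\mathcal{F}'=\{F'_1,\dots,F'_s\}$ of faces of $[a,b]^n$, $X(Z,a,b,\mathcal{F}')=\{(x,z)\in[a,b]^n\times\mathbb{R}^m\mid(x,z)\in Z,\ x\in\bigcup_{i=1}^s F'_i\}$. For a face $F$ of $[a,b]^n$, $l(F)=\{j\mid\hat x_j=a\ \forall\hat x\in F\}$ and $u(F)=\{j\mid\hat x_j=b\ \forall\hat x\in F\}$. A collection of faces is permutation-invariant if, for each face $F$ in it and each permutation matrix $Q$, the face $\{Qx\mid x\in F\}$ is also in it. $x\ge_m y$ means $\sum_{i=1}^j x_{[i]}\ge\sum_{i=1}^j y_{[i]}$ for $j<n$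 with equality for $j=n$ ($x_{[i]}$ the $i$-th largest entry). *)

theory Defs
  imports "HOL-Analysis.Analysis" "HOL-Library.Multiset"
begin

text \<open>Permutation matrices: 0/1 entries, exactly one 1 in each row and each column.\<close>
definition permutation_matrix :: "real^'n^'n \<Rightarrow> bool" where
  "permutation_matrix Q \<longleftrightarrow>
     (\<forall>i j. Q $ i $ j = 0 \<or> Q $ i $ j = 1) \<and>
     (\<forall>i. \<exists>!j. Q $ i $ j = 1) \<and> (\<forall>j. \<exists>!i. Q $ i $ j = 1)"

text \<open>The box [a,b]^n.\<close>
definition cube :: "real \<Rightarrow> real \<Rightarrow> (real^'n) set" where
  "cube a b = {x. \<forall>i. a \<le> x $ i \<and> x $ i \<le> b}"

definition perm_invariant_x :: "((real^'n) \<times> (real^'m)) set \<Rightarrow> bool" where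
  "perm_invariant_x Z \<longleftrightarrow>
     (\<forall>x z Q. (x, z) \<in> Z \<and> permutation_matrix Q \<longrightarrow> (Q *v x, z) \<in> Z)"

definition perm_invariant_faces :: "(real^'n) set set \<Rightarrow> bool" where
  "perm_invariant_faces \<F> \<longleftrightarrow>
     (\<forall>F\<in>\<F>. \<forall>Q. permutation_matrix Q \<longrightarrow> ((*v) Q) ` F \<in> \<F>)"

definition Xset :: "((real^'n) \<times> (real^'m)) set \<Rightarrow> real \<Rightarrow> real \<Rightarrow> (real^'n) set set
                     \<Rightarrow> ((real^'n) \<times> (real^'m)) set" where
  "Xset Z a b \<F>' = {(x, z). x \<in> cube a b \<and> (x, z) \<in> Z \<and> x \<in> \<Union>\<F>'}"

definition lset :: "real \<Rightarrow> (real^'n) set \<Rightarrow> 'n set" where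
  "lset a F = {j. \<forall>y\<in>F. y $ j = a}"

definition uset :: "real \<Rightarrow> (real^'n) set \<Rightarrow> 'n set" where
  "uset b F = {j. \<forall>y\<in>F. y $ j = b}"

text \<open>1-based position of an index in the linear order of the index type
  (so the index type is identified with {1,...,n}, n = CARD('n)).\<close>
definition pos :: "'n::{finite,linorder} \<Rightarrow> nat" where
  "pos j = card {i. i < j} + 1"

text \<open>Entries of x sorted in decreasing order: (dsorted x) ! (i-1) = x_[i].\<close>
definition dsorted :: "real^'n \<Rightarrow> real list" where
  "dsorted x = rev (sorted_list_of_multiset (image_mset (\<lambda>i. x $ i) (mset_set UNIV)))"

text \<open>Majorization  u \<ge>_m x.\<close>
definition majorizes :: "real^'n \<Rightarrow> real^'n \<Rightarrow> bool" where
  "majorizes u x \<longleftrightarrow>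
     (\<forall>j. 1 \<le> j \<and> j < CARD('n) \<longrightarrow>
          (\<Sum>i<j. dsorted x ! i) \<le> (\<Sum>i<j. dsorted u ! i)) \<and>
     (\<Sum>i<CARD('n). dsorted u ! i) = (\<Sum>i<CARD('n). dsorted x ! i)"

end

theory Submission
  imports Defs
begin

text \<open>
  Both sides are invariant under permuting the \<open>x\<close>-coordinates, and every point of
  \<open>X(Z,a,b,\<F>)\<close> can be permuted into decreasing order, which moves its face to one of
  the faces indexed by \<open>I\<close> and its \<open>x\<close>-part to a vector majorizing the original.
  The sum of the \<open>j\<close> largest entries is a convex function, linear on decreasing vectors,
  so the right-hand side is convex; this gives the inclusion \<open>\<subseteq>\<close>.
  Conversely, by Rado's theorem a vector majorized by a sorted \<open>u\<close> is a convex
  combination of permutations of \<open>u\<close>, all of which stay in the convex hull.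
\<close>

section \<open>Ranks in a finite linear order\<close>

definition idx_rank :: "'n::{finite,linorder} \<Rightarrow> nat" where
  "idx_rank j = card {i. i < j}"

lemma pos_eq_idx_rank: "pos j = idx_rank j + 1"
  by (simp add: pos_def idx_rank_def)

lemma strict_mono_idx_rank: "strict_mono (idx_rank :: 'n::{finite,linorder} \<Rightarrow> nat)"
  unfolding strict_mono_def idx_rank_def by (auto intro: psubset_card_mono)

lemma idx_rank_less_card: "idx_rank (j::'n::{finite,linorder}) < CARD('n)"
  unfolding idx_rank_def by (rule psubset_card_mono) auto

lemma idx_rank_less_card_eq_UNIV [simp]: "{i::'n::{finite,linorder}. idx_rank i < CARD('n)} = UNIV"
  using idx_rank_less_card by auto

lemma range_idx_rank: "range (idx_rank :: 'n::{finite,linorder} \<Rightarrow> nat) = {..<CARD('n)}"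
proof -
  have "inj (idx_rank :: 'n \<Rightarrow> nat)"
    using strict_mono_idx_rank by (rule strict_mono_imp_inj_on)
  then have "card (range (idx_rank :: 'n \<Rightarrow> nat)) = card {..<CARD('n)}"
    by (simp add: card_image)
  moreover have "range (idx_rank :: 'n \<Rightarrow> nat) \<subseteq> {..<CARD('n)}"
    using idx_rank_less_card by auto
  ultimately show ?thesis by (simp add: card_subset_eq)
qed

definition idx_of_rank :: "nat \<Rightarrow> 'n::{finite,linorder}" where
  "idx_of_rank = inv idx_rank"

lemma idx_rank_of_rank: "k < CARD('n) \<Longrightarrow> idx_rank (idx_of_rank k :: 'n::{finite,linorder}) = k"
  unfolding idx_of_rank_def by (metis f_inv_into_f lessThan_iff range_idx_rank)

lemma idx_of_rank_rank: "idx_of_rank (idx_rank (j::'n::{finite,linorder})) = j"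
  unfolding idx_of_rank_def
  by (simp add: strict_mono_idx_rank strict_mono_imp_inj_on)

lemma bij_betw_idx_of_rank:
  "j \<le> CARD('n) \<Longrightarrow> bij_betw idx_of_rank {..<j} {i::'n::{finite,linorder}. idx_rank i < j}"
  by (rule bij_betw_byWitness[where f' = idx_rank])
     (auto simp: idx_rank_of_rank idx_of_rank_rank)

lemma bij_betw_idx_of_rank_UNIV: "bij_betw idx_of_rank {..<CARD('n)} (UNIV :: 'n::{finite,linorder} set)"
  using bij_betw_idx_of_rank[OF order_refl, where 'n = 'n] by simp

lemma card_idx_rank_less: "j \<le> CARD('n) \<Longrightarrow> card {i::'n::{finite,linorder}. idx_rank i < j} = j"
  by (metis bij_betw_same_card bij_betw_idx_of_rank card_lessThan)

lemma sum_idx_rank_less: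
  "j \<le> CARD('n) \<Longrightarrow>
     (\<Sum>i | idx_rank i < j. f i) = (\<Sum>k<j. f (idx_of_rank k :: 'n::{finite,linorder}))"
  using sum.reindex_bij_betw[OF bij_betw_idx_of_rank, of j f] by simp

lemma sum_UNIV_by_rank:
  "(\<Sum>i\<in>UNIV. f i) = (\<Sum>k<CARD('n). f (idx_of_rank k :: 'n::{finite,linorder}))"
  using sum_idx_rank_less[OF order_refl, of f] by simp

lemma down_closed_eq_idx_rank_less:
  fixes D :: "'n::{finite,linorder} set"
  assumes "\<And>i j. j \<in> D \<Longrightarrow> i \<le> j \<Longrightarrow> i \<in> D"
  shows "D = {j. idx_rank j < card D}"
proof (intro set_eqI iffI)
  fix j :: 'n assume j: "j \<in> D"
  have "{i. i < j} \<subseteq> D - {j}" using assms j by auto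
  then have "idx_rank j \<le> card (D - {j})" unfolding idx_rank_def by (intro card_mono) auto
  also have "\<dots> < card D" using j by (meson card_Diff1_less finite)
  finally show "j \<in> {j. idx_rank j < card D}" by simp
next
  fix j :: 'n assume j: "j \<in> {j. idx_rank j < card D}"
  show "j \<in> D"
  proof (rule ccontr)
    assume "j \<notin> D"
    then have "D \<subseteq> {i. i < j}" using assms by (metis linorder_not_less mem_Collect_eq subsetI)
    then have "card D \<le> idx_rank j" unfolding idx_rank_def by (intro card_mono) auto
    with j show False by simp
  qed
qed

section \<open>Permuting coordinates\<close>

definition permute_vec :: "('n \<Rightarrow> 'n) \<Rightarrow> real^'n \<Rightarrow> real^'n" where
  "permute_vec s x = (\<chi> i. x $ s i)"

lemma permute_vec_nth [simp]: "permute_vec s x $ i = x $ s i"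
  by (simp add: permute_vec_def)

definition perm_matrix :: "('n::finite \<Rightarrow> 'n) \<Rightarrow> real^'n^'n" where
  "perm_matrix s = (\<chi> i j. if j = s i then 1 else 0)"

lemma perm_matrix_mult_vec: "(*v) (perm_matrix s) = permute_vec (s :: 'n::finite \<Rightarrow> 'n)"
proof (rule ext)
  fix x :: "real^'n"
  have "(\<Sum>j\<in>UNIV. (if j = s i then 1 else 0) * x $ j) = (\<Sum>j\<in>UNIV. if j = s i then x $ j else 0)"
    for i :: 'n by (rule sum.cong) auto
  then show "perm_matrix s *v x = permute_vec s x"
    by (simp add: perm_matrix_def matrix_vector_mult_def permute_vec_def vec_eq_iff)
qed

lemma permutation_matrix_perm_matrix: "bij s \<Longrightarrow> permutation_matrix (perm_matrix s)"
  unfolding permutation_matrix_def perm_matrix_def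
  by (auto simp: bij_iff) metis

lemma perm_invariant_xD:
  "perm_invariant_x Z \<Longrightarrow> bij s \<Longrightarrow> (x, z) \<in> Z \<Longrightarrow> (permute_vec s x, z) \<in> Z"
  unfolding perm_invariant_x_def
  by (metis perm_matrix_mult_vec permutation_matrix_perm_matrix)

lemma perm_invariant_facesD:
  "perm_invariant_faces \<F> \<Longrightarrow> bij s \<Longrightarrow> F \<in> \<F> \<Longrightarrow> permute_vec s ` F \<in> \<F>"
  unfolding perm_invariant_faces_def
  by (metis perm_matrix_mult_vec permutation_matrix_perm_matrix)

lemma bij_betw_vimage: "bij s \<Longrightarrow> bij_betw s (s -` A) A"
  by (metis bij_betw_subset bij_is_surj subset_UNIV surj_image_vimage_eq)

lemma sum_permute_vec: "bij s \<Longrightarrow> (\<Sum>i\<in>s -` A. permute_vec s x $ i) = (\<Sum>i\<in>A. x $ i)"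
  using sum.reindex_bij_betw[OF bij_betw_vimage, of s "\<lambda>i. x $ i" A] by simp

section \<open>Sorting permutations\<close>

lemma sum_diff_two_points:
  fixes f g :: "'n::finite \<Rightarrow> real"
  assumes "i \<noteq> j" "\<And>k. k \<noteq> i \<Longrightarrow> k \<noteq> j \<Longrightarrow> f k = g k"
  shows "sum f UNIV - sum g UNIV = f i + f j - g i - g j"
proof -
  have split: "sum h UNIV = h i + h j + sum h (UNIV - {i} - {j})" for h :: "'n \<Rightarrow> real"
    using assms(1) by (simp add: sum.remove[of UNIV i] sum.remove[of "UNIV - {i}" j])
  have "sum f (UNIV - {i} - {j}) = sum g (UNIV - {i} - {j})"
    using assms(2) by (intro sum.cong) auto
  then show ?thesis using split[of f] split[of g] by simp
qed

text \<open>A permutation maximising \<open>-\<Sum>k g (s k) * rank k\<close> has no inversion: swapping one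
  strictly increases the objective.\<close>
lemma exists_sorting_perm:
  fixes g :: "'n::{finite,linorder} \<Rightarrow> real"
  shows "\<exists>s :: 'n \<Rightarrow> 'n. bij s \<and> antimono (\<lambda>i. g (s i))"
proof -
  define \<Phi> where "\<Phi> s = - (\<Sum>k\<in>UNIV. g (s k) * real (idx_rank k))" for s :: "'n \<Rightarrow> 'n"
  define S where "S = {s :: 'n \<Rightarrow> 'n. bij s}"
  have fin: "finite (\<Phi> ` S)" by simp
  have ne: "\<Phi> ` S \<noteq> {}" unfolding S_def using bij_id by blast
  obtain s0 where s0: "s0 \<in> S" "\<Phi> s0 = Max (\<Phi> ` S)" using Max_in[OF fin ne] by auto
  have max: "\<Phi> s \<le> \<Phi> s0" if "s \<in> S" for s using s0(2) fin that by simp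
  have "antimono (\<lambda>i. g (s0 i))"
  proof (rule antimonoI, rule ccontr)
    fix i j :: 'n assume ij: "i \<le> j" and inv: "\<not> g (s0 j) \<le> g (s0 i)"
    then have "i < j" by (cases "i = j") auto
    define t where "t k = (if k = i then j else if k = j then i else k)" for k
    have "bij t" by (rule o_bij[where g = t]) (auto simp: t_def fun_eq_iff)
    then have "s0 \<circ> t \<in> S" using s0(1) unfolding S_def using bij_comp by blast
    have "\<Phi> (s0 \<circ> t) - \<Phi> s0
        = g (s0 i) * real (idx_rank i) + g (s0 j) * real (idx_rank j)
          - g (s0 (t i)) * real (idx_rank i) - g (s0 (t j)) * real (idx_rank j)"
      unfolding \<Phi>_def using \<open>i < j\<close> by (simp add: sum_diff_two_points t_def)
    also have "\<dots> = (g (s0 j) - g (s0 i)) * (real (idx_rank j) - real (idx_rank i))"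
      using \<open>i < j\<close> by (simp add: t_def algebra_simps)
    also have "\<dots> > 0"
      using inv strict_monoD[OF strict_mono_idx_rank \<open>i < j\<close>] by (intro mult_pos_pos) auto
    finally show False using max[OF \<open>s0 \<circ> t \<in> S\<close>] by simp
  qed
  then show ?thesis using s0(1) unfolding S_def by blast
qed

lemma dsorted_permute_vec: "bij s \<Longrightarrow> dsorted (permute_vec s x) = dsorted (x::real^'n::finite)"
proof -
  assume "bij s"
  have "(($) (permute_vec s x)) = ($) x \<circ> s" by (simp add: fun_eq_iff)
  then have "image_mset (($) (permute_vec s x)) (mset_set UNIV)
      = image_mset (($) x) (image_mset s (mset_set UNIV))"
    by (simp only: multiset.map_comp)
  also have "image_mset s (mset_set UNIV) = mset_set UNIV"
    using \<open>bij s\<close> by (simp add: image_mset_mset_set bij_is_inj bij_is_surj)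
  finally show ?thesis
    unfolding dsorted_def by (rule arg_cong[where f = "\<lambda>M. rev (sorted_list_of_multiset M)"])
qed

lemma dsorted_antimono:
  fixes v :: "real^'n::{finite,linorder}"
  assumes "antimono (\<lambda>i. v $ i)"
  shows "dsorted v = map (\<lambda>k. v $ idx_of_rank k) [0..<CARD('n)]"
proof -
  let ?xs = "map (\<lambda>k. v $ idx_of_rank k) [0..<CARD('n)]"
  have "mset_set (UNIV::'n set) = image_mset idx_of_rank (mset_set {..<CARD('n)})"
    using bij_betw_idx_of_rank_UNIV[where 'n = 'n] by (simp add: bij_betw_def image_mset_mset_set)
  then have "image_mset (\<lambda>i. v $ i) (mset_set UNIV)
      = image_mset (\<lambda>k. v $ idx_of_rank k) (mset_set {..<CARD('n)})"
    by (simp only: multiset.map_comp comp_def)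
  also have "\<dots> = mset ?xs"
    by (simp only: lessThan_atLeast0 mset_upt mset_map)
  finally have mset_xs: "image_mset (\<lambda>i. v $ i) (mset_set UNIV) = mset ?xs" .
  have sort_xs: "sort ?xs = rev ?xs"
  proof (rule properties_for_sort)
    show "sorted (rev ?xs)" unfolding sorted_rev_iff_nth_mono
    proof (intro allI impI)
      fix i j assume "i \<le> j" "j < length ?xs"
      then have "(idx_of_rank i :: 'n) \<le> idx_of_rank j"
        using strict_mono_less_eq[OF strict_mono_idx_rank, of "idx_of_rank i :: 'n" "idx_of_rank j"]
        by (simp add: idx_rank_of_rank)
      then show "?xs ! j \<le> ?xs ! i" using antimonoD[OF assms] \<open>j < length ?xs\<close> \<open>i \<le> j\<close> by simp
    qed
  qed simp
  show ?thesis unfolding dsorted_def by (simp only: mset_xs sorted_list_of_multiset_mset sort_xs rev_rev_ident)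
qed

section \<open>Sums of the largest entries\<close>

definition top_sum :: "nat \<Rightarrow> real^'n \<Rightarrow> real" where
  "top_sum j x = (\<Sum>i<j. dsorted x ! i)"

lemma top_sum_antimono:
  fixes v :: "real^'n::{finite,linorder}"
  assumes "antimono (\<lambda>i. v $ i)" "j \<le> CARD('n)"
  shows "top_sum j v = (\<Sum>i | idx_rank i < j. v $ i)"
  unfolding top_sum_def dsorted_antimono[OF assms(1)] sum_idx_rank_less[OF assms(2)]
  using assms(2) by (intro sum.cong) auto

lemma top_sum_permute_vec:
  "bij s \<Longrightarrow> top_sum j (permute_vec s x) = top_sum j x"
  by (simp add: top_sum_def dsorted_permute_vec)

lemma exists_sorting_perm_vec:
  fixes x :: "real^'n::{finite,linorder}"
  obtains s where "bij s" "antimono (\<lambda>i. permute_vec s x $ i)"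
  using exists_sorting_perm[of "\<lambda>i. x $ i"] by auto

text \<open>On a sorted vector no \<open>j\<close> coordinates sum to more than the first \<open>j\<close>: pair the
  coordinates of \<open>A\<close> outside the first \<open>j\<close> bijectively with the first \<open>j\<close> outside \<open>A\<close>.\<close>
lemma sum_le_sum_idx_rank_less:
  fixes y :: "real^'n::{finite,linorder}"
  assumes sorted: "antimono (\<lambda>i. y $ i)" and j: "j \<le> CARD('n)" and "card A = j"
  shows "(\<Sum>i\<in>A. y $ i) \<le> (\<Sum>i | idx_rank i < j. y $ i)"
proof -
  define T where "T = {i::'n. idx_rank i < j}"
  have "card (A - T) = card (T - A)"
    using \<open>card A = j\<close> card_idx_rank_less[OF j] card_Diff_subset_Int[of A T] card_Diff_subset_Int[of T A]
    unfolding T_def by (simp add: Int_commute)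
  then obtain h where h: "bij_betw h (A - T) (T - A)" using finite_same_card_bij[OF finite finite] by blast
  have "y $ i \<le> y $ h i" if "i \<in> A - T" for i
  proof -
    have "h i \<in> T - A" using h that by (meson bij_betwE)
    then have "idx_rank (h i) < idx_rank i" using that unfolding T_def by auto
    then have "h i < i" using strict_mono_less[OF strict_mono_idx_rank] by blast
    then show ?thesis using antimonoD[OF sorted] by simp
  qed
  then have "(\<Sum>i\<in>A - T. y $ i) \<le> (\<Sum>i\<in>A - T. y $ h i)" by (rule sum_mono)
  also have "\<dots> = (\<Sum>i\<in>T - A. y $ i)" using sum.reindex_bij_betw[OF h] .
  finally have "(\<Sum>i\<in>A - T. y $ i) \<le> (\<Sum>i\<in>T - A. y $ i)" .
  moreover have "(\<Sum>i\<in>A. y $ i) = (\<Sum>i\<in>A \<inter> T. y $ i) + (\<Sum>i\<in>A - T. y $ i)"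
    "(\<Sum>i\<in>T. y $ i) = (\<Sum>i\<in>A \<inter> T. y $ i) + (\<Sum>i\<in>T - A. y $ i)"
    using sum.Int_Diff[of A "\<lambda>i. y $ i" T] sum.Int_Diff[of T "\<lambda>i. y $ i" A] by (simp_all add: Int_commute)
  ultimately show ?thesis unfolding T_def by linarith
qed

lemma sum_le_top_sum:
  fixes x :: "real^'n::{finite,linorder}"
  assumes "j \<le> CARD('n)" "card A = j"
  shows "(\<Sum>i\<in>A. x $ i) \<le> top_sum j x"
proof -
  obtain s where s: "bij s" "antimono (\<lambda>i. permute_vec s x $ i)"
    by (rule exists_sorting_perm_vec)
  have "card (s -` A) = j"
    using bij_betw_same_card[OF bij_betw_vimage[OF s(1)]] assms(2) by simp
  have "(\<Sum>i\<in>A. x $ i) = (\<Sum>i\<in>s -` A. permute_vec s x $ i)"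
    using sum_permute_vec[OF s(1)] by simp
  also have "\<dots> \<le> (\<Sum>i | idx_rank i < j. permute_vec s x $ i)"
    by (rule sum_le_sum_idx_rank_less[OF s(2) assms(1) \<open>card (s -` A) = j\<close>])
  also have "\<dots> = top_sum j x"
    using top_sum_antimono[OF s(2) assms(1)] top_sum_permute_vec[OF s(1)] by simp
  finally show ?thesis .
qed

lemma top_sum_attained:
  fixes x :: "real^'n::{finite,linorder}"
  assumes "j \<le> CARD('n)"
  obtains B :: "'n set" where "card B = j" "top_sum j x = (\<Sum>i\<in>B. x $ i)"
proof -
  obtain s where s: "bij s" "antimono (\<lambda>i. permute_vec s x $ i)"
    by (rule exists_sorting_perm_vec)
  define B where "B = s ` {i. idx_rank i < j}"
  have "s -` B = {i. idx_rank i < j}"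
    unfolding B_def using bij_is_inj[OF s(1)] by (simp add: inj_vimage_image_eq)
  then have "card B = j"
    using bij_betw_same_card[OF bij_betw_vimage[OF s(1)], of B] card_idx_rank_less[OF assms] by simp
  moreover have "top_sum j x = (\<Sum>i\<in>B. x $ i)"
    using top_sum_antimono[OF s(2) assms] top_sum_permute_vec[OF s(1)]
      sum_permute_vec[OF s(1), where A = B] \<open>s -` B = _\<close> by simp
  ultimately show ?thesis by (rule that)
qed

lemma top_sum_card: "top_sum CARD('n) (x::real^'n::{finite,linorder}) = (\<Sum>i\<in>UNIV. x $ i)"
proof -
  obtain B where "card B = CARD('n)" "top_sum CARD('n) x = (\<Sum>i\<in>B. x $ i)"
    using top_sum_attained[OF order_refl] by blast
  then show ?thesis using card_eq_UNIV_imp_eq_UNIV[of B] by simp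
qed

lemma top_sum_combination_le:
  fixes x y :: "real^'n::{finite,linorder}"
  assumes "j \<le> CARD('n)" "0 \<le> t" "0 \<le> v"
  shows "top_sum j (t *\<^sub>R x + v *\<^sub>R y) \<le> t * top_sum j x + v * top_sum j y"
proof -
  obtain B where B: "card B = j" "top_sum j (t *\<^sub>R x + v *\<^sub>R y) = (\<Sum>i\<in>B. (t *\<^sub>R x + v *\<^sub>R y) $ i)"
    using top_sum_attained[OF assms(1)] by blast
  then have "top_sum j (t *\<^sub>R x + v *\<^sub>R y) = t * (\<Sum>i\<in>B. x $ i) + v * (\<Sum>i\<in>B. y $ i)"
    by (simp add: sum.distrib sum_distrib_left)
  also have "\<dots> \<le> t * top_sum j x + v * top_sum j y"
    using sum_le_top_sum[OF assms(1) B(1)] assms(2,3) by (intro add_mono mult_left_mono) auto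
  finally show ?thesis .
qed

lemma majorizes_iff_top_sum:
  "majorizes u x \<longleftrightarrow>
     (\<forall>j\<le>CARD('n). top_sum j x \<le> top_sum j u) \<and> top_sum CARD('n) u = top_sum CARD('n) (x::real^'n::finite)"
proof -
  have "top_sum j x \<le> top_sum j u"
    if "\<forall>j. 1 \<le> j \<and> j < CARD('n) \<longrightarrow> top_sum j x \<le> top_sum j u"
      "top_sum CARD('n) u = top_sum CARD('n) x" "j \<le> CARD('n)" for j
    using that by (cases "j = 0 \<or> j = CARD('n)") (auto simp: top_sum_def)
  then show ?thesis unfolding majorizes_def top_sum_def[symmetric] by auto
qed

section \<open>Rado's theorem\<close>

lemma summation_by_parts:
  fixes a d :: "nat \<Rightarrow> real"
  shows "(\<Sum>k<Suc M. a k * d k) =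
           (\<Sum>k<M. (a k - a (Suc k)) * (\<Sum>i<Suc k. d i)) + a M * (\<Sum>i<Suc M. d i)"
  by (induction M) (simp_all add: algebra_simps)

lemma sum_antimono_mult_nonneg:
  fixes a d :: "nat \<Rightarrow> real"
  assumes "\<And>k. Suc k < n \<Longrightarrow> a (Suc k) \<le> a k"
    and "\<And>j. j \<le> n \<Longrightarrow> 0 \<le> (\<Sum>i<j. d i)" and "(\<Sum>i<n. d i) = 0"
  shows "0 \<le> (\<Sum>k<n. a k * d k)"
proof (cases n)
  case (Suc M)
  have "0 \<le> (\<Sum>k<M. (a k - a (Suc k)) * (\<Sum>i<Suc k. d i))"
  proof (rule sum_nonneg)
    fix k assume "k \<in> {..<M}"
    then have "0 \<le> a k - a (Suc k)" "0 \<le> (\<Sum>i<Suc k. d i)"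
      using assms(1)[of k] assms(2)[of "Suc k"] Suc by simp_all
    then show "0 \<le> (a k - a (Suc k)) * (\<Sum>i<Suc k. d i)" by simp
  qed
  then show ?thesis using assms(3) Suc by (simp only: summation_by_parts)
qed simp

lemma sum_initial_permuted_le_top_sum:
  fixes x :: "real^'n::{finite,linorder}" and p :: "'n \<Rightarrow> 'n"
  assumes "bij p" "j \<le> CARD('n)"
  shows "(\<Sum>k<j. x $ p (idx_of_rank k)) \<le> top_sum j x"
proof -
  have inj: "inj_on p {i. idx_rank i < j}" using bij_is_inj[OF assms(1)] inj_on_subset by blast
  have "(\<Sum>k<j. x $ p (idx_of_rank k)) = (\<Sum>i\<in>p ` {i. idx_rank i < j}. x $ i)"
    using sum_idx_rank_less[OF assms(2), of "\<lambda>i. x $ p i"] sum.reindex[OF inj, where g = "\<lambda>i. x $ i"]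
    by simp
  also have "\<dots> \<le> top_sum j x"
    using card_image[OF inj] card_idx_rank_less[OF assms(2)] by (intro sum_le_top_sum[OF assms(2)]) simp
  finally show ?thesis .
qed

text \<open>Sorting \<open>w\<close> decreasingly by \<open>p\<close>, the difference \<open>w \<bullet> (u \<circ> p\<^sup>-\<^sup>1) - w \<bullet> x\<close>
  becomes an Abel sum whose partial sums are the majorization gaps.\<close>
lemma inner_le_inner_permute_majorizing:
  fixes u x w :: "real^'n::{finite,linorder}"
  assumes u: "antimono (\<lambda>i. u $ i)" and "majorizes u x"
  obtains s where "bij s" "w \<bullet> x \<le> w \<bullet> permute_vec s u"
proof -
  obtain p where p: "bij p" "antimono (\<lambda>i. permute_vec p w $ i)"
    by (rule exists_sorting_perm_vec)
  define e :: "nat \<Rightarrow> 'n" where "e = idx_of_rank"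
  define c where "c k = w $ p (e k)" for k
  define d where "d k = u $ e k - x $ p (e k)" for k
  have maj: "\<And>j. j \<le> CARD('n) \<Longrightarrow> top_sum j x \<le> top_sum j u"
    "top_sum CARD('n) u = top_sum CARD('n) x"
    using \<open>majorizes u x\<close> unfolding majorizes_iff_top_sum by auto
  have "w \<bullet> x = (\<Sum>i\<in>UNIV. w $ p i * x $ p i)"
    using sum.reindex_bij_betw[OF p(1), of "\<lambda>i. w $ i * x $ i"] by (simp add: inner_vec_def)
  moreover have "w \<bullet> permute_vec (inv p) u = (\<Sum>i\<in>UNIV. w $ p i * u $ i)"
    using sum.reindex_bij_betw[OF p(1), of "\<lambda>i. w $ i * u $ inv p i"] bij_is_inj[OF p(1)]
    by (simp add: inner_vec_def)
  ultimately have "w \<bullet> permute_vec (inv p) u - w \<bullet> x = (\<Sum>i\<in>UNIV. w $ p i * (u $ i - x $ p i))"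
    by (simp add: sum_subtractf right_diff_distrib)
  also have "\<dots> = (\<Sum>k<CARD('n). c k * d k)"
    unfolding c_def d_def e_def by (rule sum_UNIV_by_rank)
  also have "0 \<le> \<dots>"
  proof (rule sum_antimono_mult_nonneg)
    fix k assume "Suc k < CARD('n)"
    then have "e k \<le> e (Suc k)"
      using strict_mono_less_eq[OF strict_mono_idx_rank, of "e k" "e (Suc k)"]
      by (simp add: e_def idx_rank_of_rank)
    then show "c (Suc k) \<le> c k" using antimonoD[OF p(2)] unfolding c_def by simp
  next
    fix j assume j: "j \<le> CARD('n)"
    have "(\<Sum>k<j. x $ p (e k)) \<le> top_sum j x"
      unfolding e_def by (rule sum_initial_permuted_le_top_sum[OF p(1) j])
    moreover have "(\<Sum>k<j. u $ e k) = top_sum j u"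
      using top_sum_antimono[OF u j] sum_idx_rank_less[OF j, of "\<lambda>i. u $ i"] unfolding e_def by simp
    ultimately show "0 \<le> (\<Sum>i<j. d i)" using maj(1)[OF j] unfolding d_def by (simp add: sum_subtractf)
  next
    have "(\<Sum>k<CARD('n). x $ p (e k)) = (\<Sum>i\<in>UNIV. x $ i)"
      using sum_UNIV_by_rank[of "\<lambda>i. x $ p i"] sum.reindex_bij_betw[OF p(1), of "\<lambda>i. x $ i"]
      unfolding e_def by simp
    moreover have "(\<Sum>k<CARD('n). u $ e k) = (\<Sum>i\<in>UNIV. u $ i)"
      unfolding e_def by (rule sum_UNIV_by_rank[symmetric])
    ultimately show "(\<Sum>i<CARD('n). d i) = 0"
      using maj(2) unfolding d_def top_sum_card by (simp add: sum_subtractf)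
  qed
  finally show ?thesis using that[of "inv p"] p(1) bij_imp_bij_inv by auto
qed

lemma majorized_in_convex_hull_permutations:
  fixes u x :: "real^'n::{finite,linorder}"
  assumes "antimono (\<lambda>i. u $ i)" "majorizes u x"
  shows "x \<in> convex hull {permute_vec s u | s. bij s}"
proof (rule ccontr)
  let ?P = "{permute_vec s u | s. bij s}"
  assume "x \<notin> convex hull ?P"
  moreover have "finite ?P" by (simp add: setcompr_eq_image)
  then have "closed (convex hull ?P)"
    by (simp add: compact_imp_closed compact_convex_hull finite_imp_compact)
  ultimately obtain w c where wc: "w \<bullet> x < c" "\<forall>y\<in>convex hull ?P. c < w \<bullet> y"
    using separating_hyperplane_closed_point[OF convex_convex_hull] by blast
  obtain s where "bij s" "(- w) \<bullet> x \<le> (- w) \<bullet> permute_vec s u"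
    using inner_le_inner_permute_majorizing[OF assms] by blast
  moreover have "permute_vec s u \<in> convex hull ?P" using \<open>bij s\<close> by (intro hull_inc) blast
  ultimately show False using wc by force
qed

section \<open>The convex set on the right-hand side\<close>

lemma convex_majorization_relaxation:
  fixes C :: "((real^'n::{finite,linorder}) \<times> (real^'m::finite)) set"
  assumes "convex C"
  shows "convex {(x, z). \<exists>u. (u, z) \<in> C \<and> antimono (\<lambda>i. u $ i) \<and> majorizes u x}"
    (is "convex ?R")
  unfolding convex_def
proof (intro ballI allI impI)
  fix p q and t v :: real
  assume "p \<in> ?R" "q \<in> ?R" and t: "0 \<le> t" and v: "0 \<le> v" and "t + v = 1"
  then obtain x1 z1 u1 x2 z2 u2 where
    1: "p = (x1, z1)" "(u1, z1) \<in> C" "antimono (\<lambda>i. u1 $ i)" "majorizes u1 x1" and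
    2: "q = (x2, z2)" "(u2, z2) \<in> C" "antimono (\<lambda>i. u2 $ i)" "majorizes u2 x2"
    by blast
  define u where "u = t *\<^sub>R u1 + v *\<^sub>R u2"
  define x where "x = t *\<^sub>R x1 + v *\<^sub>R x2"
  have "(u, t *\<^sub>R z1 + v *\<^sub>R z2) \<in> C"
    using \<open>convex C\<close> 1(2) 2(2) t v \<open>t + v = 1\<close> unfolding convex_def u_def by force
  moreover have su: "antimono (\<lambda>i. u $ i)"
    using 1(3) 2(3) t v unfolding u_def by (auto intro!: antimonoI add_mono mult_left_mono dest: antimonoD)
  moreover have "majorizes u x" unfolding majorizes_iff_top_sum
  proof (intro conjI allI impI)
    fix j :: nat assume j: "j \<le> CARD('n)"
    have "top_sum j x \<le> t * top_sum j x1 + v * top_sum j x2"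
      unfolding x_def by (rule top_sum_combination_le[OF j t v])
    also have "\<dots> \<le> t * top_sum j u1 + v * top_sum j u2"
      using 1(4) 2(4) j t v unfolding majorizes_iff_top_sum by (intro add_mono mult_left_mono) auto
    also have "\<dots> = top_sum j u"
      unfolding top_sum_antimono[OF su j] top_sum_antimono[OF 1(3) j] top_sum_antimono[OF 2(3) j]
      by (simp add: u_def sum.distrib sum_distrib_left)
    finally show "top_sum j x \<le> top_sum j u" .
  next
    have "sum (($) u) UNIV = t * sum (($) u1) UNIV + v * sum (($) u2) UNIV"
      "sum (($) x) UNIV = t * sum (($) x1) UNIV + v * sum (($) x2) UNIV"
      unfolding u_def x_def by (simp_all add: sum.distrib sum_distrib_left)
    then show "top_sum CARD('n) u = top_sum CARD('n) x"
      using 1(4) 2(4) unfolding majorizes_iff_top_sum top_sum_card by simp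
  qed
  ultimately show "t *\<^sub>R p + v *\<^sub>R q \<in> ?R" using 1(1) 2(1) unfolding x_def by auto
qed

lemma convex_section: "convex S \<Longrightarrow> convex {y. (y, z) \<in> S}"
proof -
  assume "convex S"
  then have "convex (fst ` (S \<inter> UNIV \<times> {z}))"
    by (intro convex_linear_image linear_fst convex_Int convex_Times) auto
  moreover have "fst ` (S \<inter> UNIV \<times> {z}) = {y. (y, z) \<in> S}" by force
  ultimately show ?thesis by simp
qed

section \<open>Permutations of the disjunctive set\<close>

definition standard_face :: "real \<Rightarrow> real \<Rightarrow> (real^'n::{finite,linorder}) set \<Rightarrow> bool" where
  "standard_face a b F \<longleftrightarrow> (\<exists>p q. p < q \<and> q \<le> CARD('n) + 1 \<and>
     uset b F = {j. pos j \<in> {1..p}} \<and> lset a F = {j. pos j \<in> {q..CARD('n)}})"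

lemma standard_faceI:
  fixes F :: "(real^'n::{finite,linorder}) set"
  assumes "D \<subseteq> E" and "uset b F = D" and "lset a F = - E"
    and D: "\<And>i j. j \<in> D \<Longrightarrow> i \<le> j \<Longrightarrow> i \<in> D"
    and E: "\<And>i j. j \<in> E \<Longrightarrow> i \<le> j \<Longrightarrow> i \<in> E"
  shows "standard_face a b F"
  unfolding standard_face_def
proof (intro exI conjI)
  show "card D < card E + 1" using \<open>D \<subseteq> E\<close> by (simp add: card_mono less_Suc_eq_le)
  show "card E + 1 \<le> CARD('n) + 1" by (simp add: card_mono)
  show "uset b F = {j. pos j \<in> {1..card D}}"
    unfolding \<open>uset b F = D\<close> pos_eq_idx_rank
    by (subst down_closed_eq_idx_rank_less[OF D]) auto
  show "lset a F = {j. pos j \<in> {card E + 1..CARD('n)}}"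
    unfolding \<open>lset a F = - E\<close> pos_eq_idx_rank
    using idx_rank_less_card by (subst down_closed_eq_idx_rank_less[OF E]) (auto simp: Suc_le_eq)
qed

context
  fixes a b :: real and Z :: "((real^'n::{finite,linorder}) \<times> (real^'m::finite)) set"
    and \<F> :: "(real^'n::{finite,linorder}) set set"
  assumes Z: "perm_invariant_x Z" and \<F>: "perm_invariant_faces \<F>"
begin

lemma permute_vec_in_Xset:
  assumes "bij s" "(x, z) \<in> Xset Z a b \<F>"
  shows "(permute_vec s x, z) \<in> Xset Z a b \<F>"
proof -
  obtain F where x: "x \<in> cube a b" "(x, z) \<in> Z" "F \<in> \<F>" "x \<in> F"
    using assms(2) unfolding Xset_def by auto
  have "permute_vec s x \<in> \<Union>\<F>"
    using perm_invariant_facesD[OF \<F> assms(1) x(3)] x(4) by blast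
  moreover have "permute_vec s x \<in> cube a b" using x(1) unfolding cube_def by simp
  ultimately show ?thesis using perm_invariant_xD[OF Z assms(1) x(2)] unfolding Xset_def by simp
qed

lemma permute_vec_in_convex_hull_Xset:
  assumes "bij s" "(x, z) \<in> convex hull Xset Z a b \<F>"
  shows "(permute_vec s x, z) \<in> convex hull Xset Z a b \<F>"
proof -
  define h where "h = (\<lambda>(y, z'). (permute_vec s y, z' :: real^'m))"
  have "linear h" by (rule linearI) (auto simp: h_def vec_eq_iff)
  have "h (x, z) \<in> h ` (convex hull Xset Z a b \<F>)" using assms(2) by blast
  also have "\<dots> = convex hull (h ` Xset Z a b \<F>)" by (rule convex_hull_linear_image[OF \<open>linear h\<close>])
  also have "\<dots> \<subseteq> convex hull Xset Z a b \<F>"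
    using permute_vec_in_Xset[OF assms(1)] by (intro hull_mono) (auto simp: h_def)
  finally show ?thesis by (simp add: h_def)
qed

lemma majorized_in_convex_hull_Xset:
  assumes "(u, z) \<in> convex hull Xset Z a b \<F>" "antimono (\<lambda>i. u $ i)" "majorizes u x"
  shows "(x, z) \<in> convex hull Xset Z a b \<F>"
proof -
  have "{permute_vec s u | s. bij s} \<subseteq> {y. (y, z) \<in> convex hull Xset Z a b \<F>}"
    using permute_vec_in_convex_hull_Xset[OF _ assms(1)] by blast
  then have "convex hull {permute_vec s u | s. bij s} \<subseteq> {y. (y, z) \<in> convex hull Xset Z a b \<F>}"
    by (intro hull_minimal convex_section convex_convex_hull)
  then show ?thesis using majorized_in_convex_hull_permutations[OF assms(2,3)] by blast
qed

text \<open>Sort \<open>x\<close> by a key that puts the coordinates fixed to \<open>b\<close> on \<open>F\<close> first and those fixed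
  to \<open>a\<close> last; ties in \<open>x\<close> are broken so that the permuted face becomes standard.\<close>
lemma sorted_permutation_in_standard_face:
  assumes "a < b" and "F \<in> \<F>" and "(x, z) \<in> Xset Z a b {F}"
  obtains s F' where "bij s" "F' \<in> \<F>" "standard_face a b F'"
    "(permute_vec s x, z) \<in> Xset Z a b {F'}" "antimono (\<lambda>i. permute_vec s x $ i)"
proof -
  have x: "x \<in> cube a b" "(x, z) \<in> Z" "x \<in> F" using assms(3) unfolding Xset_def by auto
  define U where "U = uset b F"
  define L where "L = lset a F"
  have xU: "x $ j = b" if "j \<in> U" for j using x(3) that unfolding U_def uset_def by auto
  have xL: "x $ j = a" if "j \<in> L" for j using x(3) that unfolding L_def lset_def by auto
  have xab: "a \<le> x $ j" "x $ j \<le> b" for j using x(1) unfolding cube_def by auto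
  have UL: "j \<notin> L" if "j \<in> U" for j using xU xL \<open>a < b\<close> that by force
  define key where "key i = (if i \<in> U then b + 1 else if i \<in> L then a - 1 else x $ i)" for i
  obtain s :: "'n \<Rightarrow> 'n" where s: "bij s" "antimono (\<lambda>i. key (s i))" using exists_sorting_perm by blast
  have key_le: "key (s j) \<le> key (s i)" if "i \<le> j" for i j using antimonoD[OF s(2) that] by simp
  define F' where "F' = permute_vec s ` F"
  show ?thesis
  proof
    show "bij s" by (fact s(1))
    show "F' \<in> \<F>" unfolding F'_def by (rule perm_invariant_facesD[OF \<F> s(1) assms(2)])
    show "standard_face a b F'"
    proof (rule standard_faceI)
      show "{j. s j \<in> U} \<subseteq> {j. s j \<notin> L}" using UL by auto
      show "uset b F' = {j. s j \<in> U}" "lset a F' = - {j. s j \<notin> L}"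
        unfolding F'_def U_def L_def uset_def lset_def by auto
      show "i \<in> {j. s j \<in> U}" if "j \<in> {j. s j \<in> U}" "i \<le> j" for i j
        using key_le[OF that(2)] that(1) xab[of "s i"] \<open>a < b\<close> unfolding key_def
        by (auto split: if_splits)
      show "i \<in> {j. s j \<notin> L}" if "j \<in> {j. s j \<notin> L}" "i \<le> j" for i j
        using key_le[OF that(2)] that(1) xab[of "s j"] \<open>a < b\<close> UL unfolding key_def
        by (auto split: if_splits)
    qed
    show "(permute_vec s x, z) \<in> Xset Z a b {F'}"
      using permute_vec_in_Xset[OF s(1), of x z] x \<open>F \<in> \<F>\<close> unfolding Xset_def F'_def cube_def
      by (auto intro: perm_invariant_xD[OF Z s(1)])
    show "antimono (\<lambda>i. permute_vec s x $ i)"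
    proof (rule antimonoI)
      fix i j :: 'n assume "i \<le> j"
      then show "permute_vec s x $ j \<le> permute_vec s x $ i"
        using key_le[OF \<open>i \<le> j\<close>] xU xL xab \<open>a < b\<close> UL unfolding key_def
        by (auto split: if_splits)
    qed
  qed
qed

lemma majorized_by_standard_face_point:
  assumes "a < b" and "(x, z) \<in> Xset Z a b \<F>"
  obtains u where "(u, z) \<in> convex hull (\<Union>F\<in>{F\<in>\<F>. standard_face a b F}. Xset Z a b {F})"
    "antimono (\<lambda>i. u $ i)" "majorizes u x"
proof -
  obtain F where F: "F \<in> \<F>" "(x, z) \<in> Xset Z a b {F}" using assms(2) unfolding Xset_def by auto
  obtain s F' where s: "bij s" "F' \<in> \<F>" "standard_face a b F'"
    "(permute_vec s x, z) \<in> Xset Z a b {F'}" "antimono (\<lambda>i. permute_vec s x $ i)"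
    by (rule sorted_permutation_in_standard_face[OF assms(1) F])
  have "(permute_vec s x, z) \<in> convex hull (\<Union>F\<in>{F\<in>\<F>. standard_face a b F}. Xset Z a b {F})"
    using s(2-4) by (intro hull_inc) blast
  moreover have "majorizes (permute_vec s x) x"
    unfolding majorizes_def dsorted_permute_vec[OF s(1)] by simp
  ultimately show ?thesis using s(5) that by blast
qed

end

section \<open>The convex hull\<close>

theorem mainTheorem15:
  fixes a b :: real
    and Z :: "((real^('n::{finite,linorder})) \<times> (real^'m)) set"
    and \<F> :: "(real^('n::{finite,linorder})) set set"
  assumes "a < b"
    and "perm_invariant_x Z"
    and "finite \<F>"
    and "\<forall>F\<in>\<F>. F face_of cube a b"
    and "perm_invariant_faces \<F>"
  defines "I \<equiv> {F\<in>\<F>. \<exists>p q. p < q \<and> q \<le> CARD('n) + 1 \<and>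
                    uset b F = {j. pos j \<in> {1..p}} \<and>
                    lset a F = {j. pos j \<in> {q..CARD('n)}}}"
  shows "convex hull (Xset Z a b \<F>) =
           {(x, z). \<exists>u. (u, z) \<in> convex hull (\<Union>F\<in>I. Xset Z a b {F}) \<and>
                       (\<forall>i j. i \<le> j \<longrightarrow> u $ j \<le> u $ i) \<and>
                       majorizes u x}"
    (is "convex hull ?X = ?R")
proof
  have I: "I = {F\<in>\<F>. standard_face a b F}" unfolding I_def standard_face_def ..
  have "(x, z) \<in> ?R" if x: "(x, z) \<in> ?X" for x z
  proof -
    obtain u where "(u, z) \<in> convex hull (\<Union>F\<in>I. Xset Z a b {F})" "antimono (\<lambda>i. u $ i)" "majorizes u x"
      by (rule majorized_by_standard_face_point[OF assms(2,5,1) x, folded I])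
    then show ?thesis unfolding antimono_def by blast
  qed
  then have "?X \<subseteq> ?R" by auto
  moreover have "convex ?R"
    using convex_majorization_relaxation[OF convex_convex_hull] unfolding antimono_def .
  ultimately show "convex hull ?X \<subseteq> ?R" by (rule hull_minimal)
next
  have sub: "convex hull (\<Union>F\<in>I. Xset Z a b {F}) \<subseteq> convex hull ?X"
    unfolding I_def Xset_def by (intro hull_mono) auto
  have "(x, z) \<in> convex hull ?X"
    if "(u, z) \<in> convex hull (\<Union>F\<in>I. Xset Z a b {F})" "\<forall>i j. i \<le> j \<longrightarrow> u $ j \<le> u $ i"
      "majorizes u x" for x z u
  proof (rule majorized_in_convex_hull_Xset[OF assms(2,5)])
    show "(u, z) \<in> convex hull ?X" using that(1) sub by blast
    show "antimono (\<lambda>i. u $ i)" using that(2) by (simp add: antimono_def)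
  qed (fact that(3))
  then show "?R \<subseteq> convex hull ?X" by auto
qed

end
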